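(* For $m\ge3$ and $n\geq 1$, the zero-free chromatic polynomial of $B_1(m,n)=(B(m,n),\{uu_1^1\})$ is $\chi^b_{B_1(m,n)}(\lambda)=\lambda\gamma_m^{n-1}\gamma_{m+1}$, where $\gamma_j=\frac{(\lambda-1)^{j-1}-(-1)^{j-1}}{\lambda}$.
   Context: The book graph $B(m,n)$ has vertices $\{u,v\}\cup\{u_j^i:1\le i\le n,1\le j\le m-2\}$ and consists of the $n$ cycles $uu_1^i\cdots u_{m-2}^ivu$ sharing the edge $uv$; in $(B(m,n),\{uu_1^1\})$ the edge $uu_1^1$ is the only negative edge. A zero-free coloring in $2k$ signed colors is a map $c:V\to\{-k,\ldots,-1,1,\ldots,k\}$, proper if $c(x)\ne\sigma(e)c(y)$ for every edge $e=xy$; the zero-free chromatic polynomial is the polynomial whose value at $\lambda=2k$ counts proper zero-free colorings. *)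

theory Defs
  imports "HOL-Computational_Algebra.Polynomial" "HOL-Library.FuncSet" Complex_Main
begin

text \<open>A signed graph \<open>(G, \<Sigma>)\<close> is a graph together with the set \<open>\<Sigma>\<close> of its negative edges.\<close>

record 'a signed_graph =
  verts :: "'a set"
  edges :: "'a set set"
  neg_edges :: "'a set set"

definition edge_sign :: "('a, 'b) signed_graph_scheme \<Rightarrow> 'a set \<Rightarrow> int" where
  "edge_sign G e = (if e \<in> neg_edges G then -1 else 1)"

definition zero_free_colors :: "nat \<Rightarrow> int set" where
  "zero_free_colors k = {- int k..-1} \<union> {1..int k}"

text \<open>Colorings are extensional functions, so that maps agreeing on the vertices are counted once.\<close>

definition proper_zero_free_colorings ::
    "('a, 'b) signed_graph_scheme \<Rightarrow> nat \<Rightarrow> ('a \<Rightarrow> int) set" where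
  "proper_zero_free_colorings G k =
     {c \<in> verts G \<rightarrow>\<^sub>E zero_free_colors k.
        \<forall>x y. {x, y} \<in> edges G \<longrightarrow> c x \<noteq> edge_sign G {x, y} * c y}"

definition is_zero_free_chromatic_poly ::
    "('a, 'b) signed_graph_scheme \<Rightarrow> real poly \<Rightarrow> bool" where
  "is_zero_free_chromatic_poly G p \<longleftrightarrow>
     (\<forall>k. poly p (real (2 * k)) = real (card (proper_zero_free_colorings G k)))"

text \<open>Uniqueness holds for every \<open>G\<close>, existence for finite \<open>G\<close>; both are proved below.\<close>

definition zero_free_chromatic_poly :: "('a, 'b) signed_graph_scheme \<Rightarrow> real poly" where
  "zero_free_chromatic_poly G = (THE p. is_zero_free_chromatic_poly G p)"

lemma is_zero_free_chromatic_poly_unique: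
  assumes "is_zero_free_chromatic_poly G p" "is_zero_free_chromatic_poly G q"
  shows "p = q"
proof (rule ccontr)
  assume "p \<noteq> q"
  then have "finite {x. poly (p - q) x = 0}"
    by (intro poly_roots_finite) simp
  moreover have "range (\<lambda>k. real (2 * k)) \<subseteq> {x. poly (p - q) x = 0}"
    using assms by (auto simp: is_zero_free_chromatic_poly_def)
  ultimately have "finite (range (\<lambda>k::nat. real (2 * k)))"
    by (rule finite_subset[rotated])
  moreover have "inj (\<lambda>k::nat. real (2 * k))"
    by (auto intro: injI)
  ultimately show False
    using finite_imageD by blast
qed

lemma zero_free_chromatic_poly_eqI:
  "is_zero_free_chromatic_poly G p \<Longrightarrow> zero_free_chromatic_poly G = p"
  unfolding zero_free_chromatic_poly_def
  by (blast intro: the_equality is_zero_free_chromatic_poly_unique)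

text \<open>
  Existence is by deletion and contraction. A triple \<open>(x, y, s)\<close> encodes the condition
  \<open>c x \<noteq> s * c y\<close>; triples allow the loops and parallel edges that contraction creates.
\<close>

lemma finite_zero_free_colors: "finite (zero_free_colors k)"
  and card_zero_free_colors: "card (zero_free_colors k) = 2 * k"
proof -
  show "finite (zero_free_colors k)"
    by (simp add: zero_free_colors_def)
  have "{- int k..-1} \<inter> {1..int k} = {}" by auto
  then show "card (zero_free_colors k) = 2 * k"
    by (simp add: zero_free_colors_def card_Un_disjoint)
qed

lemma zero_free_colors_mult:
  "a \<in> zero_free_colors k \<Longrightarrow> s = 1 \<or> s = -1 \<Longrightarrow> s * a \<in> zero_free_colors k"
  by (auto simp: zero_free_colors_def)

definition triple_colorings :: "'a set \<Rightarrow> ('a \<times> 'a \<times> int) set \<Rightarrow> nat \<Rightarrow> ('a \<Rightarrow> int) set" where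
  "triple_colorings V S k =
     {c \<in> V \<rightarrow>\<^sub>E zero_free_colors k. \<forall>(x, y, s) \<in> S. c x \<noteq> s * c y}"

lemma finite_triple_colorings: "finite V \<Longrightarrow> finite (triple_colorings V S k)"
  unfolding triple_colorings_def
  by (rule finite_subset[of _ "V \<rightarrow>\<^sub>E zero_free_colors k"])
     (auto intro: finite_PiE finite_zero_free_colors)

definition contract_triple :: "'a \<Rightarrow> 'a \<Rightarrow> int \<Rightarrow> 'a \<times> 'a \<times> int \<Rightarrow> 'a \<times> 'a \<times> int" where
  "contract_triple x y s = (\<lambda>(a, b, t).
     (if a = x then y else a, if b = x then y else b,
      (if a = x then s else 1) * t * (if b = x then s else 1)))"

lemma card_contract_triple:
  assumes "x \<in> V" "y \<in> V" "x \<noteq> y" "s = 1 \<or> s = -1" and S: "S \<subseteq> V \<times> V \<times> {1, -1}"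
  shows "card {c \<in> triple_colorings V S k. c x = s * c y} =
         card (triple_colorings (V - {x}) (contract_triple x y s ` S) k)"
proof -
  have S': "a \<in> V" "b \<in> V" "t = 1 \<or> t = -1" if "(a, b, t) \<in> S" for a b t
    using S that by auto
  have "bij_betw (\<lambda>c. restrict c (V - {x})) {c \<in> triple_colorings V S k. c x = s * c y}
          (triple_colorings (V - {x}) (contract_triple x y s ` S) k)"
  proof (rule bij_betw_byWitness[where f' = "\<lambda>c. c(x := s * c y)"])
    show "\<forall>c\<in>{c \<in> triple_colorings V S k. c x = s * c y}.
            (restrict c (V - {x}))(x := s * restrict c (V - {x}) y) = c"
      using assms(1-3) by (auto simp: triple_colorings_def fun_eq_iff PiE_def extensional_def)
    show "\<forall>c\<in>triple_colorings (V - {x}) (contract_triple x y s ` S) k.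
            restrict (c(x := s * c y)) (V - {x}) = c"
      by (auto simp: triple_colorings_def fun_eq_iff PiE_def extensional_def)
    show "(\<lambda>c. restrict c (V - {x})) ` {c \<in> triple_colorings V S k. c x = s * c y}
            \<subseteq> triple_colorings (V - {x}) (contract_triple x y s ` S) k"
    proof clarify
      fix c assume c: "c \<in> triple_colorings V S k" and cx: "c x = s * c y"
      have 1: "restrict c (V - {x}) \<in> (V - {x}) \<rightarrow>\<^sub>E zero_free_colors k"
        using c by (auto simp: triple_colorings_def)
      have 2: "restrict c (V - {x}) a' \<noteq> t' * restrict c (V - {x}) b'"
        if "(a', b', t') = contract_triple x y s (a, b, t)" "(a, b, t) \<in> S" for a b t a' b' t'
      proof -
        have "c a \<noteq> t * c b"
          using c that(2) by (auto simp: triple_colorings_def)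
        then show ?thesis
          using that(1) S'[OF that(2)] cx assms(1-4)
          by (auto simp: contract_triple_def split: if_splits)
      qed
      show "restrict c (V - {x}) \<in> triple_colorings (V - {x}) (contract_triple x y s ` S) k"
        unfolding triple_colorings_def using 1 2 by force
    qed
    show "(\<lambda>c. c(x := s * c y)) ` triple_colorings (V - {x}) (contract_triple x y s ` S) k
            \<subseteq> {c \<in> triple_colorings V S k. c x = s * c y}"
    proof clarify
      fix c assume c: "c \<in> triple_colorings (V - {x}) (contract_triple x y s ` S) k"
      let ?c = "c(x := s * c y)"
      have cV: "c z \<in> zero_free_colors k" if "z \<in> V" "z \<noteq> x" for z
        using c that by (auto simp: triple_colorings_def)
      have cn: "c z = undefined" if "z \<notin> V" for z
        using c that by (auto simp: triple_colorings_def PiE_def extensional_def)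
      have 1: "?c \<in> V \<rightarrow>\<^sub>E zero_free_colors k"
        using cV cn assms(1-4) zero_free_colors_mult[OF cV[of y] assms(4)]
        by (auto simp: PiE_def extensional_def)
      have 2: "?c a \<noteq> t * ?c b" if "(a, b, t) \<in> S" for a b t
      proof -
        obtain a' b' t' where e: "contract_triple x y s (a, b, t) = (a', b', t')"
          by (cases "contract_triple x y s (a, b, t)")
        then have "c a' \<noteq> t' * c b'"
          using c that unfolding triple_colorings_def by force
        then show ?thesis
          using e S'[OF that] assms(3,4)
          by (auto simp: contract_triple_def split: if_splits)
      qed
      show "?c \<in> triple_colorings V S k \<and> ?c x = s * ?c y"
        unfolding triple_colorings_def using 1 2 assms(3) by force
    qed
  qed
  then show ?thesis
    by (rule bij_betw_same_card)
qed

lemma triple_colorings_poly: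
  assumes "finite V" "S \<subseteq> V \<times> V \<times> {1, -1}"
  shows "\<exists>p :: real poly. \<forall>k. poly p (real (2 * k)) = real (card (triple_colorings V S k))"
  using assms
proof (induction "card S" arbitrary: V S rule: less_induct)
  case less
  have finS: "finite S"
    using less.prems by (meson finite.emptyI finite.insertI finite_SigmaI finite_subset)
  show ?case
  proof (cases "S = {}")
    case True
    then show ?thesis
      using less.prems(1)
      by (intro exI[of _ "monom 1 (card V)"])
         (auto simp: triple_colorings_def card_PiE card_zero_free_colors poly_monom)
  next
    case False
    then obtain x y s where e: "(x, y, s) \<in> S" by auto
    define S' where "S' = S - {(x, y, s)}"
    have xy: "x \<in> V" "y \<in> V" "s = 1 \<or> s = -1"
      using e less.prems(2) by auto
    have S': "S' \<subseteq> V \<times> V \<times> {1, -1}" "card S' < card S"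
      using less.prems(2) card_Diff1_less[OF finS e] by (auto simp: S'_def)
    obtain p :: "real poly" where
      p: "\<And>k. poly p (real (2 * k)) = real (card (triple_colorings V S' k))"
      using less.hyps[OF S'(2) less.prems(1) S'(1)] by blast
    have "\<exists>q :: real poly. \<forall>k. poly q (real (2 * k)) =
            real (card {c \<in> triple_colorings V S' k. c x = s * c y})"
    proof (cases "x = y")
      case loop: True
      show ?thesis
      proof (cases "s = 1")
        case True
        then show ?thesis using p loop by auto
      next
        case False
        then have "c x \<noteq> s * c y" if "c \<in> triple_colorings V S' k" for c k
          using that xy loop by (auto simp: triple_colorings_def zero_free_colors_def dest!: PiE_mem)
        then have "{c \<in> triple_colorings V S' k. c x = s * c y} = {}" for k
          by blast
        then show ?thesis by (intro exI[of _ 0]) (simp only: card.empty poly_0 of_nat_0 simp_thms)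
      qed
    next
      case False
      have "card (contract_triple x y s ` S') < card S"
        using S'(2) card_image_le[of S' "contract_triple x y s"] finS by (simp add: S'_def)
      moreover have "contract_triple x y s ` S' \<subseteq> (V - {x}) \<times> (V - {x}) \<times> {1, -1}"
      proof -
        have "contract_triple x y s (a, b, t) \<in> (V - {x}) \<times> (V - {x}) \<times> {1, -1}"
          if "(a, b, t) \<in> S'" for a b t
        proof -
          have "a \<in> V" "b \<in> V" "t = 1 \<or> t = -1"
            using S'(1) that by auto
          then show ?thesis
            using xy False by (auto simp: contract_triple_def)
        qed
        then show ?thesis by (intro image_subsetI) (metis prod_cases3)
      qed
      ultimately show ?thesis
        using less.hyps[of "contract_triple x y s ` S'" "V - {x}"] less.prems(1)
          card_contract_triple[OF xy(1,2) False xy(3) S'(1)] by simp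
    qed
    then obtain q :: "real poly" where
      q: "\<And>k. poly q (real (2 * k)) = real (card {c \<in> triple_colorings V S' k. c x = s * c y})"
      by blast
    have "real (card (triple_colorings V S k)) = poly (p - q) (real (2 * k))" for k
    proof -
      let ?A = "{c \<in> triple_colorings V S' k. c x = s * c y}"
      have "S = insert (x, y, s) S'"
        using e by (auto simp: S'_def)
      then have "triple_colorings V S k = triple_colorings V S' k - ?A"
        by (auto simp: triple_colorings_def)
      moreover have "finite ?A" "card ?A \<le> card (triple_colorings V S' k)"
        using finite_triple_colorings[OF less.prems(1)] by (auto intro: card_mono)
      ultimately show ?thesis
        using p q by (simp add: card_Diff_subset of_nat_diff del: of_nat_mult)
    qed
    then show ?thesis by metis
  qed
qed

lemma zero_free_chromatic_poly_correct:
  assumes "finite (verts G)" "edges G \<subseteq> Pow (verts G)"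
  shows "is_zero_free_chromatic_poly G (zero_free_chromatic_poly G)"
proof -
  define S where "S = {(x, y, edge_sign G {x, y}) | x y. {x, y} \<in> edges G}"
  have "S \<subseteq> verts G \<times> verts G \<times> {1, -1}"
    using assms(2) by (auto simp: S_def edge_sign_def)
  moreover have "proper_zero_free_colorings G k = triple_colorings (verts G) S k" for k
    by (auto simp: proper_zero_free_colorings_def triple_colorings_def S_def)
  ultimately obtain p where "is_zero_free_chromatic_poly G p"
    using triple_colorings_poly[OF assms(1)] unfolding is_zero_free_chromatic_poly_def by metis
  then show ?thesis
    using zero_free_chromatic_poly_eqI by metis
qed

text \<open>\<open>Page i j\<close> is the vertex \<open>u\<^sub>j\<^sup>i\<close>, the \<open>j\<close>-th inner vertex of the \<open>i\<close>-th cycle.\<close>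

datatype book_vertex = U | V | Page nat nat

definition book_verts :: "nat \<Rightarrow> nat \<Rightarrow> book_vertex set" where
  "book_verts m n = {U, V} \<union> {Page i j | i j. 1 \<le> i \<and> i \<le> n \<and> 1 \<le> j \<and> j \<le> m - 2}"

definition book_cycle_edges :: "nat \<Rightarrow> nat \<Rightarrow> book_vertex set set" where
  "book_cycle_edges m i =
     {{U, Page i 1}} \<union> {{Page i j, Page i (j + 1)} | j. 1 \<le> j \<and> j < m - 2} \<union>
     {{Page i (m - 2), V}, {V, U}}"

definition book_edges :: "nat \<Rightarrow> nat \<Rightarrow> book_vertex set set" where
  "book_edges m n = (\<Union>i\<in>{1..n}. book_cycle_edges m i)"

definition B1 :: "nat \<Rightarrow> nat \<Rightarrow> book_vertex signed_graph" where
  "B1 m n = \<lparr>verts = book_verts m n, edges = book_edges m n, neg_edges = {{U, Page 1 1}}\<rparr>"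

text \<open>The polynomial \<open>\<gamma>\<^sub>j\<close> in the indeterminate \<open>\<lambda>\<close>, which is \<open>[:0, 1:]\<close>; the division is exact.\<close>

definition gamma_poly :: "nat \<Rightarrow> real poly" where
  "gamma_poly j = (([:0, 1:] - 1) ^ (j - 1) - (-1) ^ (j - 1)) div [:0, 1:]"

lemma gamma_poly_exact:
  "[:0, 1:] * gamma_poly j = ([:0, 1:] - 1) ^ (j - 1) - (-1) ^ (j - 1)"
proof -
  have "poly (([:0, 1:] - 1) ^ (j - 1) - (-1) ^ (j - 1)) (0::real) = 0"
    by (simp add: poly_power)
  then have "[:0, 1::real:] dvd ([:0, 1:] - 1) ^ (j - 1) - (-1) ^ (j - 1)"
    by (simp only: poly_eq_0_iff_dvd minus_zero)
  then show ?thesis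
    unfolding gamma_poly_def by (rule dvd_mult_div_cancel)
qed

end

theory Submission
  imports Defs
begin

text \<open>
  Fix the colors \<open>a \<noteq> b\<close> of \<open>u\<close> and \<open>v\<close>; the pages are then colored independently. A positive page
  is a proper path coloring from \<open>a\<close> to \<open>b\<close>, and there are \<open>\<gamma>\<^sub>m(\<lambda>)\<close> of these. Switching \<open>u\<close> turns
  the negative page into a positive one from \<open>-a\<close> to \<open>b\<close>. Summed over all \<open>b \<noteq> a\<close>, these
  colorings form the proper colorings of a path with one more inner vertex, from \<open>-a\<close> to \<open>a\<close>;
  since \<open>-a \<noteq> a\<close>, there are \<open>\<gamma>\<^bsub>m+1\<^esub>(\<lambda>)\<close> of them.
\<close>

section \<open>Colorings of a path with prescribed end colors\<close>

text \<open>Only the \<open>r\<close> inner vertices belong to the map; the end colors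
  \<open>a\<close> and \<open>b\<close> are patched in at the indices 0 and \<open>Suc r\<close>.
  All pages share their ends, so the ends must be parameters for the pages to be counted
  independently.\<close>

definition path_colorings :: "'c set \<Rightarrow> nat \<Rightarrow> 'c \<Rightarrow> 'c \<Rightarrow> (nat \<Rightarrow> 'c) set" where
  "path_colorings C r a b =
     {g \<in> {1..r} \<rightarrow>\<^sub>E C. \<forall>j\<le>r. (g(0 := a, Suc r := b)) j \<noteq> (g(0 := a, Suc r := b)) (Suc j)}"

lemma finite_path_colorings: "finite C \<Longrightarrow> finite (path_colorings C r a b)"
  unfolding path_colorings_def
  by (rule finite_subset[of _ "{1..r} \<rightarrow>\<^sub>E C"]) (auto intro: finite_PiE)

lemma restrict_mem_path_colorings_iff:
  assumes "g \<in> {1..r} \<rightarrow> C"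
  shows "restrict g {1..r} \<in> path_colorings C r a b \<longleftrightarrow>
           (\<forall>j\<le>r. (g(0 := a, Suc r := b)) j \<noteq> (g(0 := a, Suc r := b)) (Suc j))"
proof -
  have "((restrict g {1..r})(0 := a, Suc r := b)) j = (g(0 := a, Suc r := b)) j" if "j \<le> Suc r" for j
    using that by auto
  then show ?thesis
    using assms by (simp add: path_colorings_def del: fun_upd_apply restrict_apply)
qed

text \<open>The color \<open>x\<close> plays two roles: it belongs to the last inner vertex of the
  longer path and is the end color of the shorter one.\<close>

lemma path_colorings_Suc_iff:
  assumes "g \<in> {1..r} \<rightarrow>\<^sub>E C" "x \<in> C"
  shows "g(Suc r := x) \<in> path_colorings C (Suc r) a b \<longleftrightarrow> x \<noteq> b \<and> g \<in> path_colorings C r a x"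
proof -
  have "g(Suc r := x) \<in> {1..Suc r} \<rightarrow>\<^sub>E C"
    using assms by (auto simp: PiE_iff extensional_def le_Suc_eq)
  then show ?thesis
    using assms(1) by (auto simp: path_colorings_def le_Suc_eq)
qed

text \<open>Classify by the color \<open>x\<close> of the last inner vertex. This is the recursion
  behind the closed form below, and read from right to left it later absorbs the sum over the colors
  of \<open>V\<close> into a longer path.\<close>

lemma card_path_colorings_Suc:
  assumes "finite C"
  shows "card (path_colorings C (Suc r) a b) = (\<Sum>x\<in>C - {b}. card (path_colorings C r a x))"
proof -
  have sub: "g \<in> {1..r} \<rightarrow>\<^sub>E C" if "g \<in> path_colorings C r a x" for g x
    using that by (simp add: path_colorings_def)
  have restr: "restrict g {1..r} \<in> {1..r} \<rightarrow>\<^sub>E C" "g (Suc r) \<in> C"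
    "(restrict g {1..r})(Suc r := g (Suc r)) = g"
    if "g \<in> path_colorings C (Suc r) a b" for g
    using that by (auto simp: path_colorings_def PiE_iff extensional_def fun_eq_iff)
  have "bij_betw (\<lambda>(x, g). g(Suc r := x)) (SIGMA x:C - {b}. path_colorings C r a x)
          (path_colorings C (Suc r) a b)"
  proof (rule bij_betw_byWitness[where f' = "\<lambda>g. (g (Suc r), restrict g {1..r})"])
    show "\<forall>p\<in>SIGMA x:C - {b}. path_colorings C r a x.
            (\<lambda>g. (g (Suc r), restrict g {1..r})) ((\<lambda>(x, g). g(Suc r := x)) p) = p"
      using sub by (fastforce simp: PiE_iff extensional_def fun_eq_iff)
    show "\<forall>g\<in>path_colorings C (Suc r) a b.
            (\<lambda>(x, g). g(Suc r := x)) (g (Suc r), restrict g {1..r}) = g"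
      using restr(3) by simp
    show "(\<lambda>(x, g). g(Suc r := x)) ` (SIGMA x:C - {b}. path_colorings C r a x)
            \<subseteq> path_colorings C (Suc r) a b"
      using path_colorings_Suc_iff sub by fastforce
    show "(\<lambda>g. (g (Suc r), restrict g {1..r})) ` path_colorings C (Suc r) a b
            \<subseteq> (SIGMA x:C - {b}. path_colorings C r a x)"
    proof (rule image_subsetI)
      fix g assume g: "g \<in> path_colorings C (Suc r) a b"
      show "(g (Suc r), restrict g {1..r}) \<in> (SIGMA x:C - {b}. path_colorings C r a x)"
        using path_colorings_Suc_iff[OF restr(1,2)[OF g], of a b] restr(2,3)[OF g] g by simp
    qed
  qed
  then have "card (path_colorings C (Suc r) a b) =
               card (SIGMA x:C - {b}. path_colorings C r a x)"
    by (simp add: bij_betw_same_card)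
  then show ?thesis
    using assms by (simp add: card_SigmaI finite_path_colorings)
qed

text \<open>These colorings are the walks of length \<open>Suc r\<close> from \<open>a\<close> to
  \<open>b\<close> in the complete graph on \<open>C\<close>, whose adjacency eigenvalues are
  \<open>card C - 1\<close> and -1. The factor \<open>card C\<close> on the left avoids division.
  The case \<open>a = b\<close> is carried along because the recursion for \<open>b\<close>
  different from \<open>a\<close> passes through the end color \<open>a\<close>.\<close>

lemma card_path_colorings:
  assumes "finite C" "a \<in> C" "b \<in> C"
  shows "real (card C) * real (card (path_colorings C r a b)) =
           (real (card C) - 1) ^ Suc r + ((if a = b then real (card C) else 0) - 1) * (-1) ^ Suc r"
  using assms(3)
proof (induction r arbitrary: b)
  case 0
  \<comment> \<open>Without inner vertices the single edge joins the two ends, and the only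
    extensional map is undefined everywhere.\<close>
  have "path_colorings C 0 a b = (if a = b then {} else {\<lambda>_. undefined})"
    by (auto simp: path_colorings_def)
  then show ?case by simp
next
  case (Suc r)
  define q where "q = real (card C)"
  have "card C \<noteq> 0"
    using assms by auto
  then have card: "real (card (C - {b})) = q - 1"
    using assms(1) Suc.prems by (simp add: q_def of_nat_diff Suc_le_eq del: card_eq_0_iff card_0_eq)
  have "q * real (card (path_colorings C (Suc r) a b)) =
          (\<Sum>x\<in>C - {b}. q * real (card (path_colorings C r a x)))"
    using assms(1) by (simp add: card_path_colorings_Suc sum_distrib_left)
  also have "\<dots> = (\<Sum>x\<in>C - {b}. (q - 1) ^ Suc r - (-1) ^ Suc r +
                      (if a = x then q * (-1) ^ Suc r else 0))"
  proof (intro sum.cong refl)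
    fix x assume "x \<in> C - {b}"
    then have "x \<in> C" by simp
    from Suc.IH[OF this]
    show "q * real (card (path_colorings C r a x)) =
        (q - 1) ^ Suc r - (-1) ^ Suc r + (if a = x then q * (-1) ^ Suc r else 0)"
      by (simp add: q_def left_diff_distrib del: power_Suc)
  qed
  \<comment> \<open>The extra term at \<open>x = a\<close> is met exactly once, unless
    \<open>a = b\<close> removes it from the range.\<close>
  also have "\<dots> = (q - 1) * ((q - 1) ^ Suc r - (-1) ^ Suc r) +
                  (if a = b then 0 else q * (-1) ^ Suc r)"
    using assms(1,2) by (simp add: sum.distrib card del: power_Suc)
  also have "\<dots> = (q - 1) ^ Suc (Suc r) + ((if a = b then q else 0) - 1) * (-1) ^ Suc (Suc r)"
    by (simp add: algebra_simps)
  finally show ?case by (simp add: q_def)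
qed

text \<open>Cancel the nonzero factor \<open>card C\<close>. The index is \<open>r + 2\<close>
  because a path with \<open>r\<close> inner vertices has \<open>r + 1\<close> edges, while the
  exponent in \<open>gamma_poly j\<close> is \<open>j - 1\<close>.\<close>

lemma card_path_colorings_neq:
  assumes "finite C" "a \<in> C" "b \<in> C" "a \<noteq> b"
  shows "real (card (path_colorings C r a b)) = poly (gamma_poly (r + 2)) (real (card C))"
proof -
  have "real (card C) * poly (gamma_poly (r + 2)) (real (card C)) =
          (real (card C) - 1) ^ Suc r - (-1) ^ Suc r"
    using arg_cong[OF gamma_poly_exact[of "r + 2"], of "\<lambda>p. poly p (real (card C))"]
    by (simp add: poly_power)
  also have "\<dots> = real (card C) * real (card (path_colorings C r a b))"
    using card_path_colorings[OF assms(1-3), of r] assms(4) by simp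
  finally have "real (card C) * poly (gamma_poly (r + 2)) (real (card C)) =
                  real (card C) * real (card (path_colorings C r a b))" .
  moreover have "real (card C) \<noteq> 0"
    using assms by auto
  ultimately show ?thesis
    using mult_left_cancel by metis
qed

section \<open>Splitting a coloring of the book into its pages\<close>

text \<open>The negative edge demands \<open>c U \<noteq> - c (Page 1 1)\<close>, which is the
  positive condition \<open>- c U \<noteq> c (Page 1 1)\<close>; so the sign moves into the start
  color of page 1. The edge between \<open>U\<close> and \<open>V\<close> lies on every page and is
  present since \<open>n \<ge> 1\<close>.\<close>

lemma B1_proper_iff:
  assumes "m \<ge> 3" "n \<ge> 1"
  shows "(\<forall>x y. {x, y} \<in> edges (B1 m n) \<longrightarrow> c x \<noteq> edge_sign (B1 m n) {x, y} * c y) \<longleftrightarrow>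
         c U \<noteq> c V \<and>
         (\<forall>i\<in>{1..n}. \<forall>j\<le>m - 2.
            ((\<lambda>j. c (Page i j))(0 := (if i = 1 then - c U else c U), Suc (m - 2) := c V)) j \<noteq>
            ((\<lambda>j. c (Page i j))(0 := (if i = 1 then - c U else c U), Suc (m - 2) := c V)) (Suc j))"
    (is "?L \<longleftrightarrow> ?R")
proof
  assume L: ?L
  have e: "c x \<noteq> edge_sign (B1 m n) {x, y} * c y" if "i \<in> {1..n}" "{x, y} \<in> book_cycle_edges m i"
    for x y i
  proof -
    have "{x, y} \<in> edges (B1 m n)"
      using that by (auto simp: B1_def book_edges_def)
    then show ?thesis
      using L by blast
  qed
  have U: "c U \<noteq> (if i = 1 then - c (Page i 1) else c (Page i 1))" if "i \<in> {1..n}" for i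
    using e[OF that, of U "Page i 1"]
    by (auto simp: book_cycle_edges_def edge_sign_def B1_def doubleton_eq_iff)
  have inner: "c (Page i j) \<noteq> c (Page i (Suc j))" if "i \<in> {1..n}" "1 \<le> j" "j < m - 2" for i j
    using e[OF that(1), of "Page i j" "Page i (Suc j)"] that
    by (auto simp: book_cycle_edges_def edge_sign_def B1_def doubleton_eq_iff)
  have V: "c (Page i (m - 2)) \<noteq> c V" if "i \<in> {1..n}" for i
    using e[OF that, of "Page i (m - 2)" V]
    by (auto simp: book_cycle_edges_def edge_sign_def B1_def doubleton_eq_iff)
  have UV: "c U \<noteq> c V"
    using e[of 1 U V] assms(2)
    by (auto simp: book_cycle_edges_def edge_sign_def B1_def doubleton_eq_iff)
  show ?R
  proof (intro conjI UV ballI allI impI)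
    fix i j assume i: "i \<in> {1..n}" and "j \<le> m - 2"
    \<comment> \<open>First, inner and last edge of the page path. Since \<open>m \<ge> 3\<close>,
      the index 1 stays below \<open>Suc (m - 2)\<close> and the index \<open>m - 2\<close> is
      positive, so the patched ends overwrite no page vertex.\<close>
    then consider "j = 0" | "1 \<le> j" "j < m - 2" | "j = m - 2" "j \<noteq> 0"
      by linarith
    then show "((\<lambda>j. c (Page i j))(0 := (if i = 1 then - c U else c U), Suc (m - 2) := c V)) j \<noteq>
      ((\<lambda>j. c (Page i j))(0 := (if i = 1 then - c U else c U), Suc (m - 2) := c V)) (Suc j)"
      using U[OF i] inner[OF i, of j] V[OF i] assms(1) by cases auto
  qed
next
  assume R: ?R
  have e: "((\<lambda>j. c (Page i j))(0 := (if i = 1 then - c U else c U), Suc (m - 2) := c V)) j \<noteq>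
      ((\<lambda>j. c (Page i j))(0 := (if i = 1 then - c U else c U), Suc (m - 2) := c V)) (Suc j)"
    if "i \<in> {1..n}" "j \<le> m - 2" for i j
    using R that by blast
  have U: "c U \<noteq> (if i = 1 then - c (Page i 1) else c (Page i 1))" if "i \<in> {1..n}" for i
    using e[OF that, of 0] assms(1) by (auto split: if_splits)
  have inner: "c (Page i j) \<noteq> c (Page i (Suc j))" if "i \<in> {1..n}" "1 \<le> j" "j < m - 2" for i j
    using e[OF that(1), of j] that by auto
  have V: "c (Page i (m - 2)) \<noteq> c V" if "i \<in> {1..n}" for i
    using e[OF that, of "m - 2"] assms(1) by auto
  show ?L
  proof (intro allI impI)
    fix x y assume "{x, y} \<in> edges (B1 m n)"
    then obtain i where i: "i \<in> {1..n}" and "{x, y} \<in> book_cycle_edges m i"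
      by (auto simp: B1_def book_edges_def)
    \<comment> \<open>Each edge may be read in either orientation; the condition is symmetric
      because signs are 1 or -1.\<close>
    then consider "{x, y} = {U, Page i 1}"
      | j where "1 \<le> j" "j < m - 2" "{x, y} = {Page i j, Page i (Suc j)}"
      | "{x, y} = {Page i (m - 2), V}" | "{x, y} = {V, U}"
      by (auto simp: book_cycle_edges_def)
    then show "c x \<noteq> edge_sign (B1 m n) {x, y} * c y"
    proof cases
      case 1
      then show ?thesis
        using U[OF i] by (auto simp: edge_sign_def B1_def doubleton_eq_iff split: if_splits)
    next
      case 2
      then show ?thesis
        using inner[OF i 2(1,2)] by (auto simp: edge_sign_def B1_def doubleton_eq_iff)
    next
      case 3
      then show ?thesis
        using V[OF i] by (auto simp: edge_sign_def B1_def doubleton_eq_iff)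
    next
      case 4
      then show ?thesis
        using R by (auto simp: edge_sign_def B1_def doubleton_eq_iff)
    qed
  qed
qed

text \<open>Once the colors of \<open>U\<close> and \<open>V\<close> are fixed, no condition links
  different pages, so the count is a product over the pages.\<close>

lemma card_proper_zero_free_colorings_B1:
  assumes "m \<ge> 3" "n \<ge> 1"
  shows "card (proper_zero_free_colorings (B1 m n) k) =
           (\<Sum>a\<in>zero_free_colors k. \<Sum>b\<in>zero_free_colors k - {a}. \<Prod>i\<in>{1..n}.
              card (path_colorings (zero_free_colors k) (m - 2) (if i = 1 then - a else a) b))"
proof -
  define C where "C = zero_free_colors k"
  define F where "F a b = (\<lambda>i :: nat. path_colorings C (m - 2) (if i = 1 then - a else a) b)"
    for a b :: int
  define T where "T = (SIGMA a:C. SIGMA b:C - {a}. PiE {1..n} (F a b))"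
  define f where "f c = (c U, c V, \<lambda>i\<in>{1..n}. \<lambda>j\<in>{1..m - 2}. c (Page i j))"
    for c :: "book_vertex \<Rightarrow> int"
  \<comment> \<open>The value \<open>undefined\<close> off the pages makes the glued map extensional
    on \<open>book_verts m n\<close>.\<close>
  define f' :: "int \<times> int \<times> (nat \<Rightarrow> nat \<Rightarrow> int) \<Rightarrow> book_vertex \<Rightarrow> int"
    where "f' = (\<lambda>(a, b, h) v. case v of U \<Rightarrow> a | V \<Rightarrow> b
      | Page i j \<Rightarrow> if i \<in> {1..n} \<and> j \<in> {1..m - 2} then h i j else undefined)"
  have finC: "finite C"
    by (simp add: C_def finite_zero_free_colors)
  have proper: "c \<in> proper_zero_free_colorings (B1 m n) k \<longleftrightarrow>
      c \<in> book_verts m n \<rightarrow>\<^sub>E C \<and> c U \<noteq> c V \<and>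
      (\<forall>i\<in>{1..n}. (\<lambda>j\<in>{1..m - 2}. c (Page i j)) \<in> F (c U) (c V) i)" for c
  proof (cases "c \<in> book_verts m n \<rightarrow>\<^sub>E C")
    case True
    have page: "(\<lambda>j. c (Page i j)) \<in> {1..m - 2} \<rightarrow> C" if "i \<in> {1..n}" for i
      using True that by (auto simp: book_verts_def)
    have "c \<in> proper_zero_free_colorings (B1 m n) k \<longleftrightarrow>
        (\<forall>x y. {x, y} \<in> edges (B1 m n) \<longrightarrow> c x \<noteq> edge_sign (B1 m n) {x, y} * c y)"
      using True by (simp add: proper_zero_free_colorings_def B1_def C_def)
    also have "\<dots> \<longleftrightarrow> c U \<noteq> c V \<and>
        (\<forall>i\<in>{1..n}. (\<lambda>j\<in>{1..m - 2}. c (Page i j)) \<in> F (c U) (c V) i)"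
      unfolding B1_proper_iff[OF assms] F_def
      by (intro conj_cong refl ball_cong restrict_mem_path_colorings_iff[OF page, symmetric])
    finally show ?thesis
      using True by blast
  next
    case False
    then show ?thesis
      by (simp add: proper_zero_free_colorings_def B1_def C_def)
  qed
  have "bij_betw f (proper_zero_free_colorings (B1 m n) k) T"
  proof (rule bij_betw_byWitness[where f' = f'])
    show "\<forall>c\<in>proper_zero_free_colorings (B1 m n) k. f' (f c) = c"
      unfolding Ball_def proper
      by (auto simp: f_def f'_def book_verts_def PiE_iff extensional_def fun_eq_iff
          split: book_vertex.split)
    have page: "h i \<in> {1..m - 2} \<rightarrow>\<^sub>E C" if "h \<in> PiE {1..n} (F a b)" "i \<in> {1..n}" for h a b i
      using PiE_mem[OF that] unfolding F_def path_colorings_def by blast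
    have restr: "(\<lambda>j\<in>{1..m - 2}. f' (a, b, h) (Page i j)) = h i"
      if "h \<in> PiE {1..n} (F a b)" "i \<in> {1..n}" for h a b i
      using page[OF that] that(2) by (auto simp: f'_def PiE_iff extensional_def fun_eq_iff)
    show "\<forall>t\<in>T. f (f' t) = t"
    proof
      fix t assume "t \<in> T"
      then obtain a b h where t: "t = (a, b, h)" and h: "h \<in> PiE {1..n} (F a b)"
        by (auto simp: T_def)
      have "(\<lambda>i\<in>{1..n}. \<lambda>j\<in>{1..m - 2}. f' (a, b, h) (Page i j)) = restrict h {1..n}"
        using restr[OF h] by (intro restrict_ext) simp
      also have "\<dots> = h"
        using h by (simp add: PiE_iff extensional_restrict)
      finally show "f (f' t) = t"
        unfolding t f_def by (simp add: f'_def)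
    qed
    show "f ` proper_zero_free_colorings (B1 m n) k \<subseteq> T"
      using proper by (auto simp: f_def T_def book_verts_def)
    show "f' ` T \<subseteq> proper_zero_free_colorings (B1 m n) k"
    proof (rule image_subsetI)
      fix t assume "t \<in> T"
      then obtain a b h where t: "t = (a, b, h)" and ab: "a \<in> C" "b \<in> C" "a \<noteq> b"
        and h: "h \<in> PiE {1..n} (F a b)"
        by (auto simp: T_def)
      have UV: "f' t U = a" "f' t V = b"
        by (simp_all add: t f'_def)
      have "f' t \<in> book_verts m n \<rightarrow>\<^sub>E C"
        using ab page[OF h]
        by (auto simp: t f'_def book_verts_def PiE_iff extensional_def split: book_vertex.splits)
      moreover have "(\<lambda>j\<in>{1..m - 2}. f' t (Page i j)) \<in> F (f' t U) (f' t V) i"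
        if "i \<in> {1..n}" for i
        using restr[OF h that] PiE_mem[OF h that] UV by (simp add: t)
      ultimately show "f' t \<in> proper_zero_free_colorings (B1 m n) k"
        using proper ab(3) UV by simp
    qed
  qed
  then have "card (proper_zero_free_colorings (B1 m n) k) = card T"
    by (rule bij_betw_same_card)
  also have "\<dots> = (\<Sum>a\<in>C. \<Sum>b\<in>C - {a}. \<Prod>i\<in>{1..n}. card (F a b i))"
    unfolding T_def using finC
    by (simp add: card_SigmaI card_PiE finite_PiE finite_SigmaI F_def finite_path_colorings)
  finally show ?thesis
    by (simp add: F_def C_def)
qed

section \<open>Evaluation of the sum at an even number of colors\<close>

theorem theorem4p5:
  fixes m n :: nat
  assumes "m \<ge> 3" and "n \<ge> 1"
  shows "zero_free_chromatic_poly (B1 m n) =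
           [:0, 1:] * gamma_poly m ^ (n - 1) * gamma_poly (m + 1)"
proof (rule zero_free_chromatic_poly_eqI, unfold is_zero_free_chromatic_poly_def, rule allI)
  fix k
  define C where "C = zero_free_colors k"
  define P where "P = path_colorings C (m - 2)"
  define q where "q = real (2 * k)"
  have C: "finite C" "real (card C) = q"
    by (simp_all add: C_def q_def finite_zero_free_colors card_zero_free_colors)
  \<comment> \<open>The absence of the color 0 enters here: no color is its own negative.\<close>
  have neg: "- a \<in> C" "- a \<noteq> a" if "a \<in> C" for a
    using that by (auto simp: C_def zero_free_colors_def)
  have P: "real (card (P a b)) = poly (gamma_poly m) q" if "a \<in> C" "b \<in> C" "a \<noteq> b" for a b
  proof -
    have "m - 2 + 2 = m"
      using assms(1) by simp
    then show ?thesis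
      using card_path_colorings_neq[OF C(1) that, of "m - 2"] C(2) by (simp add: P_def)
  qed
  have prod: "real (\<Prod>i\<in>{1..n}. card (P (if i = 1 then - a else a) b)) =
      poly (gamma_poly m) q ^ (n - 1) * real (card (P (- a) b))"
    if "a \<in> C" "b \<in> C - {a}" for a b
  proof -
    \<comment> \<open>Split off the negative page. Its factor stays unevaluated, since
      \<open>b\<close> may equal \<open>- a\<close>, where the count is not given by
      \<open>gamma_poly m\<close>.\<close>
    have "{1..n} = insert 1 {2..n}"
      using assms(2) by auto
    then show ?thesis
      using P[of a b] that by simp
  qed
  have "real (card (proper_zero_free_colorings (B1 m n) k)) =
      (\<Sum>a\<in>C. \<Sum>b\<in>C - {a}. real (\<Prod>i\<in>{1..n}. card (P (if i = 1 then - a else a) b)))"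
    by (simp add: card_proper_zero_free_colorings_B1[OF assms] C_def P_def)
  also have "\<dots> = (\<Sum>a\<in>C. \<Sum>b\<in>C - {a}. poly (gamma_poly m) q ^ (n - 1) * real (card (P (- a) b)))"
    using prod by (intro sum.cong refl) auto
  \<comment> \<open>The vertex \<open>V\<close> becomes one more inner vertex of the negative page,
    and the condition \<open>b \<noteq> a\<close> becomes its edge to the new end of color
    \<open>a\<close>.\<close>
  also have "\<dots> = (\<Sum>a\<in>C. poly (gamma_poly m) q ^ (n - 1) *
                    real (card (path_colorings C (Suc (m - 2)) (- a) a)))"
    by (simp add: card_path_colorings_Suc[OF C(1)] P_def sum_distrib_left)
  also have "\<dots> = (\<Sum>a\<in>C. poly (gamma_poly m) q ^ (n - 1) * poly (gamma_poly (m + 1)) q)"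
  proof (intro sum.cong refl arg_cong2[of _ _ _ _ "(*)"])
    fix a assume a: "a \<in> C"
    have "Suc (m - 2) + 2 = m + 1"
      using assms(1) by simp
    then show "real (card (path_colorings C (Suc (m - 2)) (- a) a)) = poly (gamma_poly (m + 1)) q"
      using card_path_colorings_neq[OF C(1) neg(1)[OF a] a neg(2)[OF a], of "Suc (m - 2)"] C(2)
      by metis
  qed
  \<comment> \<open>The summand no longer depends on \<open>a\<close>; the \<open>q\<close> choices
    for \<open>a\<close> give the factor \<open>[:0, 1:]\<close>.\<close>
  also have "\<dots> = poly ([:0, 1:] * gamma_poly m ^ (n - 1) * gamma_poly (m + 1)) q"
    using C(2) by (simp add: poly_power)
  finally show "poly ([:0, 1:] * gamma_poly m ^ (n - 1) * gamma_poly (m + 1)) (real (2 * k)) =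
      real (card (proper_zero_free_colorings (B1 m n) k))"
    by (simp add: q_def)
qed

end
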